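(* Let $(\eta_n)$ be a sequence of positive real numbers. For every sequence $a_n$ of nonnegative real numbers we have, with $E_{S,n}=[\tilde\theta_S-\hat\sigma a_n,\tilde\theta_S+\hat\sigma a_n]$ and $C_{S,n}=[\hat\theta_S-a_n,\hat\theta_S+a_n]$, that $$\inf_{\theta\in\mathbb{R}}P_{n,\theta}(\theta\in E_{S,n})-\inf_{\theta\in\mathbb{R}}P_{n,\theta}(\theta\in C_{S,n})\to 0$$ as $n\to\infty$. The analogous results hold for the corresponding open and half-open intervals (i.e., when both $E_{S,n}$ and $C_{S,n}$ are replaced by the open, or by the left-open or right-open half-open, intervals with the same endpoints).
   Context: For $n\ge2$ the data $y_1,\dots,y_n$ are i.i.d. $N(\theta,1)$ with $\theta\in\mathbb{R}$; $P_{n,\theta}$ denotes the distribution of the sample when $\theta$ is the true parameter (true variance $\sigma^2=1$). Let $\bar y=n^{-1}\sum_{i=1}^n y_i$, $\hat\sigma^2=(n-1)^{-1}\sum_{i=1}^n(y_i-\bar y)^2$, $\hat\sigma=\sqrt{\hat\sigma^2}$. The feasible soft-thresholding (LASSO) estimator is $\tilde\theta_S=\operatorname{sign}(\bar y)(|\bar y|-\hat\sigma\eta_n)_+$ and its known-variance version is $\hat\theta_S=\operatorname{sign}(\bar y)(|\bar y|-\eta_n)_+$, where $z_+=\max\{z,0\}$ and $\operatorname{sign}(0)=0$. *)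

theory Defs
  imports "HOL-Probability.Probability"
begin

text \<open>A sample of size \<open>n\<close> is a function on the index set \<open>{1..n}\<close>.\<close>

definition normal_sample :: "nat \<Rightarrow> real \<Rightarrow> (nat \<Rightarrow> real) measure" where
  "normal_sample n \<theta> =
     PiM {1..n} (\<lambda>_. density lborel (\<lambda>x. ennreal (normal_density \<theta> 1 x)))"

definition sample_mean :: "nat \<Rightarrow> (nat \<Rightarrow> real) \<Rightarrow> real" where
  "sample_mean n y = (\<Sum>i=1..n. y i) / real n"

definition sample_sd :: "nat \<Rightarrow> (nat \<Rightarrow> real) \<Rightarrow> real" where
  "sample_sd n y = sqrt ((\<Sum>i=1..n. (y i - sample_mean n y)\<^sup>2) / (real n - 1))"

definition soft_threshold :: "real \<Rightarrow> real \<Rightarrow> real" where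
  "soft_threshold t x = sgn x * max (\<bar>x\<bar> - t) 0"

text \<open>The threshold uses the known standard deviation 1 in \<open>soft_known\<close>
  and the estimated one in \<open>soft_feasible\<close>.\<close>

definition soft_known :: "(nat \<Rightarrow> real) \<Rightarrow> nat \<Rightarrow> (nat \<Rightarrow> real) \<Rightarrow> real" where
  "soft_known \<eta> n y = soft_threshold (\<eta> n) (sample_mean n y)"

definition soft_feasible :: "(nat \<Rightarrow> real) \<Rightarrow> nat \<Rightarrow> (nat \<Rightarrow> real) \<Rightarrow> real" where
  "soft_feasible \<eta> n y = soft_threshold (sample_sd n y * \<eta> n) (sample_mean n y)"

text \<open>The argument \<open>I\<close> maps two endpoints to an interval of one of the four types.\<close>

definition interval_known ::
  "(real \<Rightarrow> real \<Rightarrow> real set) \<Rightarrow> (nat \<Rightarrow> real) \<Rightarrow> (nat \<Rightarrow> real) \<Rightarrow> nat \<Rightarrow> (nat \<Rightarrow> real) \<Rightarrow> real set"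
where
  "interval_known I \<eta> a n y = I (soft_known \<eta> n y - a n) (soft_known \<eta> n y + a n)"

definition interval_feasible ::
  "(real \<Rightarrow> real \<Rightarrow> real set) \<Rightarrow> (nat \<Rightarrow> real) \<Rightarrow> (nat \<Rightarrow> real) \<Rightarrow> nat \<Rightarrow> (nat \<Rightarrow> real) \<Rightarrow> real set"
where
  "interval_feasible I \<eta> a n y =
     I (soft_feasible \<eta> n y - sample_sd n y * a n) (soft_feasible \<eta> n y + sample_sd n y * a n)"

definition inf_coverage :: "nat \<Rightarrow> ((nat \<Rightarrow> real) \<Rightarrow> real set) \<Rightarrow> real" where
  "inf_coverage n J =
     (INF \<theta>\<in>UNIV. measure (normal_sample n \<theta>) {y \<in> space (normal_sample n \<theta>). \<theta> \<in> J y})"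

end

theory Submission
  imports Defs "HOL-Real_Asymp.Real_Asymp"
begin

text \<open>
  Write \<open>\<delta> = sample_mean n y - \<theta>\<close>, which is \<open>N(0, 1/n)\<close> for every \<open>\<theta>\<close>. Both
  intervals are instances of one construction: threshold \<open>s \<cdot> \<eta>\<close> and half-width \<open>s \<cdot> a\<close> with a
  nonnegative scale statistic \<open>s\<close>, where \<open>s = 1\<close> in the known-variance case and
  \<open>s = sample_sd\<close> in the feasible case. Soft thresholding shifts the mean towards the origin by
  at most \<open>s \<cdot> \<eta>\<close>. If \<open>\<theta> > s \<cdot> a\<close>, covering \<open>\<theta>\<close> forces the estimate to be positive, so that
  the shift is exactly this amount, and \<open>\<theta>\<close> is covered exactly when \<open>\<delta>\<close> lies between
  \<open>s \<cdot> (\<eta> - a)\<close> and \<open>s \<cdot> (\<eta> + a)\<close>; for every other \<open>\<theta> \<ge> 0\<close> this condition on \<open>\<delta>\<close> is still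
  sufficient, and the case \<open>\<theta> \<le> 0\<close> is its mirror image. Hence the
  minimal coverage is essentially the probability of that event.

  It remains to replace \<open>s\<close> by 1. On the event \<open>\<bar>s - 1\<bar> \<le> e\<close> the endpoints \<open>s \<cdot> (\<eta> \<plusminus> a)\<close> differ
  from \<open>\<eta> \<plusminus> a\<close> by a relative error of at most \<open>e\<close>, so the event can change only if \<open>\<delta>\<close> falls
  within relative distance \<open>e\<close> of one of the two points \<open>\<eta> \<plusminus> a\<close>. The function
  \<open>x \<mapsto> \<bar>x\<bar> \<cdot> normal_density 0 \<tau> x\<close> is bounded by 1 for every \<open>\<tau>\<close>, so this has probability
  \<open>O(e)\<close>, uniformly in the points and in \<open>n\<close> (\<open>measure_normal_relative_nbhd_le\<close>). These
  neighbourhoods contain the points themselves, so the same error term absorbs the difference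
  between open and closed intervals. This yields \<open>inf_coverage_scaled_approx\<close>: the
  minimal coverage is within \<open>8 \<cdot> e + p\<close> of a quantity that does not depend on \<open>s\<close>, where \<open>p\<close>
  bounds the probability of \<open>\<bar>s - 1\<bar> > e\<close>.

  For the sample standard deviation, \<open>p\<close> tends to 0 by Chebyshev's inequality applied to
  \<open>s\<^sup>2 - 1\<close> (\<open>sample_sd_deviation\<close>), uniformly in \<open>\<theta>\<close>.
\<close>

section \<open>Soft thresholding and coverage of a point\<close>

text \<open>The common form of the feasible and the known-variance interval.\<close>

definition scaled_interval ::
  "(real \<Rightarrow> real \<Rightarrow> real set) \<Rightarrow> ((nat \<Rightarrow> real) \<Rightarrow> real) \<Rightarrow> real \<Rightarrow> real \<Rightarrow> nat \<Rightarrow> (nat \<Rightarrow> real) \<Rightarrow> real set"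
where
  "scaled_interval I s h c n y =
     I (soft_threshold (s y * h) (sample_mean n y) - s y * c)
       (soft_threshold (s y * h) (sample_mean n y) + s y * c)"

lemma interval_feasible_eq_scaled:
  "interval_feasible I \<eta> a n = scaled_interval I (sample_sd n) (\<eta> n) (a n) n"
  by (simp add: fun_eq_iff interval_feasible_def scaled_interval_def soft_feasible_def)

lemma interval_known_eq_scaled:
  "interval_known I \<eta> a n = scaled_interval I (\<lambda>_. 1) (\<eta> n) (a n) n"
  by (simp add: fun_eq_iff interval_known_def scaled_interval_def soft_known_def)

lemma soft_threshold_minus: "soft_threshold t (- x) = - soft_threshold t x"
  by (simp add: soft_threshold_def sgn_if)

text \<open>A parameter larger than the half-width \<open>b\<close> can only be covered if the estimate is positive,
  that is, if thresholding moved the mean down by exactly \<open>t\<close>.\<close>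

lemma soft_threshold_covers_imp:
  assumes "0 \<le> t" "b < \<theta>" "0 \<le> b"
    and "soft_threshold t x - b \<le> \<theta>" "\<theta> \<le> soft_threshold t x + b"
  shows "t - b \<le> x - \<theta>" "x - \<theta> \<le> t + b"
  using assms by (auto simp: soft_threshold_def sgn_if max_def abs_if split: if_splits)

lemma soft_threshold_coversI:
  assumes "0 \<le> t" "0 \<le> \<theta>" "0 \<le> b" "t - b < x - \<theta>" "x - \<theta> < t + b"
  shows "soft_threshold t x - b < \<theta>" "\<theta> < soft_threshold t x + b"
  using assms by (auto simp: soft_threshold_def sgn_if max_def abs_if split: if_splits)

lemma soft_threshold_coversI_nonpos:
  assumes "0 \<le> t" "\<theta> \<le> 0" "0 \<le> b" "- (t + b) < x - \<theta>" "x - \<theta> < - (t - b)"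
  shows "soft_threshold t x - b < \<theta>" "\<theta> < soft_threshold t x + b"
  using soft_threshold_coversI[of t "- \<theta>" b "- x"] assms by (auto simp: soft_threshold_minus)

lemma abs_scaled_diff_le:
  fixes s u e :: real
  assumes "\<bar>s - 1\<bar> \<le> e"
  shows "\<bar>s * u - u\<bar> \<le> e * \<bar>u\<bar>"
proof -
  have "\<bar>s * u - u\<bar> = \<bar>s - 1\<bar> * \<bar>u\<bar>"
    by (simp add: abs_mult[symmetric] algebra_simps)
  then show ?thesis
    using assms by (simp add: mult_right_mono)
qed

section \<open>Normal probabilities of small relative neighbourhoods\<close>

abbreviation centred_normal :: "real \<Rightarrow> real measure" where
  "centred_normal \<tau> \<equiv> density lborel (\<lambda>x. ennreal (normal_density 0 \<tau> x))"

text \<open>After rescaling to \<open>\<tau> = 1\<close> this is the elementary estimate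
  \<open>z \<le> 1 + z\<^sup>2 / 2 \<le> exp (z\<^sup>2 / 2)\<close>.\<close>

lemma abs_mult_normal_density_le:
  assumes "0 < \<tau>"
  shows "\<bar>x\<bar> * normal_density 0 \<tau> x \<le> 1"
proof -
  define z where "z = \<bar>x\<bar> / \<tau>"
  have "z \<le> 1 + z\<^sup>2 / 2"
    using zero_le_power2[of "z - 1"] by (simp add: power2_diff)
  also have "\<dots> \<le> exp (z\<^sup>2 / 2)"
    by (rule exp_ge_add_one_self)
  finally have z: "z * exp (- (z\<^sup>2 / 2)) \<le> 1"
    by (simp add: exp_minus field_simps)
  have pi: "1 \<le> sqrt (2 * pi)"
    using pi_gt3 by simp
  have "\<bar>x\<bar> * normal_density 0 \<tau> x = z * exp (- (z\<^sup>2 / 2)) / sqrt (2 * pi)"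
    using assms by (simp add: normal_density_def z_def real_sqrt_mult power_divide field_simps)
  also have "\<dots> \<le> 1"
    using order.trans[OF z pi] by (simp add: divide_le_eq)
  finally show ?thesis .
qed

text \<open>The neighbourhood has length \<open>2 \<cdot> e \<cdot> \<bar>u\<bar>\<close>, and on it \<open>\<bar>x\<bar> \<ge> \<bar>u\<bar> / 2\<close>, so by the previous estimate
  the density is at most \<open>2 / \<bar>u\<bar>\<close>. The factors \<open>\<bar>u\<bar>\<close> cancel; this is what makes the bound
  uniform in \<open>u\<close> and \<open>\<tau>\<close>.\<close>

lemma measure_normal_relative_nbhd_le:
  fixes u e \<tau> :: real
  assumes "0 < \<tau>" "0 < e" "e \<le> 1/2"
  shows "measure (centred_normal \<tau>) {x. \<bar>x - u\<bar> \<le> e * \<bar>u\<bar>} \<le> 4 * e"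
proof -
  interpret prob_space "centred_normal \<tau>"
    by (rule prob_space_normal_density) fact
  let ?B = "{u - e * \<bar>u\<bar> .. u + e * \<bar>u\<bar>}"
  have B: "{x. \<bar>x - u\<bar> \<le> e * \<bar>u\<bar>} = ?B"
    by (auto simp: abs_le_iff)
  show ?thesis
  proof (cases "u = 0")
    case True
    have "emeasure (centred_normal \<tau>) {0} = 0"
      by (simp add: emeasure_density)
    then show ?thesis
      using True assms by (simp add: B measure_def)
  next
    case False
    have *: "normal_density 0 \<tau> x \<le> 2 / \<bar>u\<bar>" if "x \<in> ?B" for x
    proof -
      have "e * \<bar>u\<bar> \<le> (1/2) * \<bar>u\<bar>"
        using assms by (intro mult_right_mono) auto
      moreover have "\<bar>u - x\<bar> \<le> e * \<bar>u\<bar>"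
        using that by (auto simp: abs_le_iff)
      ultimately have x: "\<bar>u\<bar> / 2 \<le> \<bar>x\<bar>"
        using abs_triangle_ineq2[of u x] by linarith
      have "\<bar>u\<bar> / 2 * normal_density 0 \<tau> x \<le> \<bar>x\<bar> * normal_density 0 \<tau> x"
        using x by (rule mult_right_mono) simp
      also have "\<dots> \<le> 1"
        using assms(1) by (rule abs_mult_normal_density_le)
      finally show ?thesis
        using False by (simp add: field_simps)
    qed
    have "emeasure (centred_normal \<tau>) ?B
        = (\<integral>\<^sup>+x. ennreal (normal_density 0 \<tau> x) * indicator ?B x \<partial>lborel)"
      by (simp add: emeasure_density)
    also have "\<dots> \<le> (\<integral>\<^sup>+x. ennreal (2 / \<bar>u\<bar>) * indicator ?B x \<partial>lborel)"
      by (intro nn_integral_mono) (auto simp: indicator_def intro!: ennreal_leI *)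
    also have "\<dots> = ennreal (2 / \<bar>u\<bar>) * ennreal (2 * (e * \<bar>u\<bar>))"
      using assms by (subst nn_integral_cmult_indicator) auto
    also have "\<dots> = ennreal (4 * e)"
      using assms False by (simp add: ennreal_mult[symmetric])
    finally show ?thesis
      using assms by (simp add: B emeasure_eq_measure)
  qed
qed

lemma measure_centred_normal_mirror:
  "measure (centred_normal \<tau>) {- v .. - u} = measure (centred_normal \<tau>) {u .. v}"
proof -
  have "emeasure (centred_normal \<tau>) {- v .. - u}
      = (\<integral>\<^sup>+x. ennreal (normal_density 0 \<tau> x) * indicator {- v .. - u} x \<partial>lborel)"
    by (simp add: emeasure_density)
  also have "\<dots> = (\<integral>\<^sup>+x. ennreal (normal_density 0 \<tau> (- x)) * indicator {- v .. - u} (- x) \<partial>lborel)"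
    by (subst nn_integral_real_affine[where c = "-1" and t = 0]) auto
  also have "\<dots> = (\<integral>\<^sup>+x. ennreal (normal_density 0 \<tau> x) * indicator {u .. v} x \<partial>lborel)"
    by (intro nn_integral_cong) (auto simp: normal_density_def indicator_def)
  also have "\<dots> = emeasure (centred_normal \<tau>) {u .. v}"
    by (simp add: emeasure_density)
  finally show ?thesis
    by (simp add: measure_def)
qed

section \<open>The normal sample\<close>

lemma prob_space_normal_sample: "prob_space (normal_sample n \<theta>)"
  unfolding normal_sample_def by (intro prob_space_PiM prob_space_normal_density) simp

lemma measurable_normal_sample_component [measurable]:
  "i \<in> {1..n} \<Longrightarrow> (\<lambda>y. y i) \<in> borel_measurable (normal_sample n \<theta>)"
  unfolding normal_sample_def by measurable

lemma measurable_sample_mean [measurable]: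
  "sample_mean n \<in> borel_measurable (normal_sample n \<theta>)"
  unfolding sample_mean_def by (intro borel_measurable_divide borel_measurable_sum) auto

lemma measurable_sample_sd [measurable]:
  "sample_sd n \<in> borel_measurable (normal_sample n \<theta>)"
  unfolding sample_sd_def by measurable

lemma sample_sd_nonneg: "2 \<le> n \<Longrightarrow> 0 \<le> sample_sd n y"
  by (auto simp: sample_sd_def intro!: divide_nonneg_nonneg sum_nonneg)

lemma distributed_normal_sample_component:
  assumes "i \<in> {1..n}"
  shows "distributed (normal_sample n \<theta>) lborel (\<lambda>y. y i) (normal_density \<theta> 1)"
proof -
  let ?N = "density lborel (\<lambda>x. ennreal (normal_density \<theta> 1 x))"
  have "distr (normal_sample n \<theta>) lborel (\<lambda>y. y i) = distr (normal_sample n \<theta>) ?N (\<lambda>y. y i)"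
    by (rule distr_cong) auto
  also have "\<dots> = ?N"
    unfolding normal_sample_def using assms
    by (intro distr_PiM_component prob_space_normal_density) auto
  finally show ?thesis
    using assms by (auto simp: distributed_def)
qed

lemma indep_vars_normal_sample:
  assumes "1 \<le> n"
  shows "prob_space.indep_vars (normal_sample n \<theta>) (\<lambda>_. borel) (\<lambda>i y. y i) {1..n}"
proof -
  interpret prob_space "normal_sample n \<theta>"
    by (rule prob_space_normal_sample)
  let ?N = "density lborel (\<lambda>x. ennreal (normal_density \<theta> 1 x))"
  have component: "distr (normal_sample n \<theta>) borel (\<lambda>y. y i) = ?N" if "i \<in> {1..n}" for i
  proof -
    have "distr (normal_sample n \<theta>) borel (\<lambda>y. y i) = distr (normal_sample n \<theta>) lborel (\<lambda>y. y i)"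
      by (rule distr_cong) auto
    then show ?thesis
      using distributed_distr_eq_density[OF distributed_normal_sample_component[OF that]] by simp
  qed
  have "distr (normal_sample n \<theta>) (PiM {1..n} (\<lambda>_. borel)) (\<lambda>y. \<lambda>i\<in>{1..n}. y i)
      = distr (normal_sample n \<theta>) (normal_sample n \<theta>) (\<lambda>y. y)"
    by (rule distr_cong)
       (auto simp: normal_sample_def space_PiM PiE_def extensional_restrict intro!: sets_PiM_cong)
  also have "\<dots> = PiM {1..n} (\<lambda>i. distr (normal_sample n \<theta>) borel (\<lambda>y. y i))"
    unfolding distr_id normal_sample_def
    by (rule PiM_cong) (simp_all only: component[unfolded normal_sample_def])
  finally show ?thesis
    using assms by (subst indep_vars_iff_distr_eq_PiM') auto
qed

lemma distributed_sample_mean: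
  assumes "1 \<le> n"
  shows "distributed (normal_sample n \<theta>) lborel (\<lambda>y. sample_mean n y - \<theta>)
    (normal_density 0 (1 / sqrt n))"
proof -
  interpret prob_space "normal_sample n \<theta>"
    by (rule prob_space_normal_sample)
  have "distributed (normal_sample n \<theta>) lborel (\<lambda>y. \<Sum>i\<in>{1..n}. y i)
      (normal_density (\<Sum>i\<in>{1..n}. \<theta>) (sqrt (\<Sum>i\<in>{1..n}. 1\<^sup>2)))"
    using assms
    by (intro sum_indep_normal indep_vars_normal_sample distributed_normal_sample_component) auto
  then have "distributed (normal_sample n \<theta>) lborel (\<lambda>y. - \<theta> + (1 / n) * (\<Sum>i\<in>{1..n}. y i))
      (normal_density (- \<theta> + (1 / n) * (n * \<theta>)) (\<bar>1 / n\<bar> * sqrt n))"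
    using assms by (intro normal_density_affine) auto
  then show ?thesis
    using assms by (simp add: sample_mean_def sqrt_divide_self_eq inverse_eq_divide field_simps)
qed

lemma measure_sample_mean:
  assumes "1 \<le> n" "B \<in> sets borel"
  shows "measure (normal_sample n \<theta>) {y \<in> space (normal_sample n \<theta>). sample_mean n y - \<theta> \<in> B}
    = measure (centred_normal (1 / sqrt n)) B"
proof -
  have "measure (centred_normal (1 / sqrt n)) B
      = measure (distr (normal_sample n \<theta>) lborel (\<lambda>y. sample_mean n y - \<theta>)) B"
    using distributed_distr_eq_density[OF distributed_sample_mean[OF assms(1)]] by simp
  also have "\<dots> = measure (normal_sample n \<theta>)
      ((\<lambda>y. sample_mean n y - \<theta>) -` B \<inter> space (normal_sample n \<theta>))"
    using assms by (intro measure_distr) auto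
  finally show ?thesis
    by (simp add: vimage_def Int_def conj_commute)
qed

section \<open>Consistency of the sample standard deviation\<close>

lemma (in prob_space) square_sum_indep:
  fixes X :: "'i \<Rightarrow> 'a \<Rightarrow> real"
  assumes "finite J" "indep_vars (\<lambda>_. borel) X J"
    and "\<And>i. i \<in> J \<Longrightarrow> integrable M (X i)" "\<And>i. i \<in> J \<Longrightarrow> expectation (X i) = 0"
    and "\<And>i. i \<in> J \<Longrightarrow> integrable M (\<lambda>x. (X i x)\<^sup>2)"
  shows "integrable M (\<lambda>x. (\<Sum>i\<in>J. X i x)\<^sup>2) \<and>
    expectation (\<lambda>x. (\<Sum>i\<in>J. X i x)\<^sup>2) = (\<Sum>i\<in>J. expectation (\<lambda>x. (X i x)\<^sup>2))"
  using assms
proof (induction J rule: finite_induct)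
  case empty
  then show ?case by simp
next
  case (insert i J)
  let ?S = "\<lambda>x. \<Sum>i\<in>J. X i x"
  have IH: "integrable M (\<lambda>x. (?S x)\<^sup>2)"
    "expectation (\<lambda>x. (?S x)\<^sup>2) = (\<Sum>i\<in>J. expectation (\<lambda>x. (X i x)\<^sup>2))"
    using insert.IH insert.prems indep_vars_subset[OF insert.prems(1), of J] by auto
  have indep: "indep_var borel (X i) borel ?S"
    using insert by (intro indep_vars_sum) auto
  have S: "integrable M ?S"
    using insert.prems by (intro Bochner_Integration.integrable_sum) auto
  have prod: "integrable M (\<lambda>x. X i x * ?S x)" "expectation (\<lambda>x. X i x * ?S x) = 0"
    using indep_var_integrable[OF indep] indep_var_lebesgue_integral[OF indep] S insert.prems
    by auto
  have eq: "(\<Sum>i\<in>insert i J. X i x)\<^sup>2 = (X i x)\<^sup>2 + 2 * (X i x * ?S x) + (?S x)\<^sup>2" for x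
    using insert.hyps by (simp add: power2_sum)
  show ?case
    unfolding eq using insert.hyps insert.prems IH prod by simp
qed

lemma (in prob_space) centred_square_normal:
  assumes X: "distributed M lborel X (normal_density 0 \<tau>)" and "0 < \<tau>"
  shows "integrable M (\<lambda>x. (X x)\<^sup>2 - \<tau>\<^sup>2)" "expectation (\<lambda>x. (X x)\<^sup>2 - \<tau>\<^sup>2) = 0"
    and "integrable M (\<lambda>x. ((X x)\<^sup>2 - \<tau>\<^sup>2)\<^sup>2)" "expectation (\<lambda>x. ((X x)\<^sup>2 - \<tau>\<^sup>2)\<^sup>2) = 2 * \<tau> ^ 4"
proof -
  have moment: "integrable M (\<lambda>x. X x ^ (2 * k))"
    "expectation (\<lambda>x. X x ^ (2 * k)) = fact (2 * k) / ((2 / \<tau>\<^sup>2) ^ k * fact k)" for k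
    using normal_moment_even[OF assms(2), of 0 k]
      distributed_integrable[OF X, of "\<lambda>x. x ^ (2 * k)"]
      distributed_integral[OF X, of "\<lambda>x. x ^ (2 * k)"]
    by (auto simp: has_bochner_integral_iff)
  have 2: "integrable M (\<lambda>x. (X x)\<^sup>2)" "expectation (\<lambda>x. (X x)\<^sup>2) = \<tau>\<^sup>2"
    using moment[of 1] by simp_all
  have 4: "integrable M (\<lambda>x. X x ^ 4)" "expectation (\<lambda>x. X x ^ 4) = 3 * \<tau> ^ 4"
    using moment[of 2] by (simp_all add: fact_numeral power_divide)
  show "integrable M (\<lambda>x. (X x)\<^sup>2 - \<tau>\<^sup>2)" "expectation (\<lambda>x. (X x)\<^sup>2 - \<tau>\<^sup>2) = 0"
    using 2 by (simp_all add: prob_space)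
  have eq: "((X x)\<^sup>2 - \<tau>\<^sup>2)\<^sup>2 = X x ^ 4 - 2 * \<tau>\<^sup>2 * (X x)\<^sup>2 + \<tau> ^ 4" for x
    by (simp add: power2_diff flip: power_mult)
  show "integrable M (\<lambda>x. ((X x)\<^sup>2 - \<tau>\<^sup>2)\<^sup>2)"
    "expectation (\<lambda>x. ((X x)\<^sup>2 - \<tau>\<^sup>2)\<^sup>2) = 2 * \<tau> ^ 4"
    unfolding eq using 2 4 by (simp_all add: prob_space power2_eq_square power4_eq_xxxx)
qed

text \<open>The decomposition of the centred sample variance into the contribution of the errors and
  the contribution of the estimated mean.\<close>

lemma sample_variance_decomposition:
  assumes "2 \<le> n"
  shows "(real n - 1) * ((sample_sd n y)\<^sup>2 - 1)
    = (\<Sum>i=1..n. (y i - \<theta>)\<^sup>2 - 1) - (real n * (sample_mean n y - \<theta>)\<^sup>2 - 1)"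
proof -
  define d where "d = sample_mean n y - \<theta>"
  have sum: "(\<Sum>i=1..n. y i - \<theta>) = n * d"
    using assms by (simp add: d_def sample_mean_def sum_subtractf field_simps)
  have "(\<Sum>i=1..n. (y i - sample_mean n y)\<^sup>2)
      = (\<Sum>i=1..n. (y i - \<theta>)\<^sup>2 - 2 * d * (y i - \<theta>) + d\<^sup>2)"
    by (intro sum.cong) (simp_all add: d_def power2_eq_square algebra_simps)
  also have "\<dots> = (\<Sum>i=1..n. (y i - \<theta>)\<^sup>2) - 2 * d * (\<Sum>i=1..n. y i - \<theta>) + n * d\<^sup>2"
    unfolding sum_distrib_left by (simp add: sum.distrib sum_subtractf)
  also have "\<dots> = (\<Sum>i=1..n. (y i - \<theta>)\<^sup>2) - n * d\<^sup>2"
    unfolding sum by (simp add: power2_eq_square algebra_simps)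
  finally have Q: "(\<Sum>i=1..n. (y i - sample_mean n y)\<^sup>2) = (\<Sum>i=1..n. (y i - \<theta>)\<^sup>2) - n * d\<^sup>2" .
  have "(sample_sd n y)\<^sup>2 = (\<Sum>i=1..n. (y i - sample_mean n y)\<^sup>2) / (real n - 1)"
    unfolding sample_sd_def using assms
    by (intro real_sqrt_pow2 divide_nonneg_nonneg sum_nonneg) auto
  then have "(real n - 1) * (sample_sd n y)\<^sup>2 = (\<Sum>i=1..n. (y i - sample_mean n y)\<^sup>2)"
    using assms by simp
  then show ?thesis
    unfolding Q by (simp add: d_def sum_subtractf algebra_simps)
qed

text \<open>By the decomposition, \<open>(n - 1) (s\<^sup>2 - 1)\<close> is a difference of two centred variables with
  second moments \<open>2 n\<close> and \<open>2\<close>; bounding the square of a difference by twice the sum of the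
  squares avoids computing their covariance.\<close>

lemma sample_sd_deviation:
  assumes "2 \<le> n" "0 < e"
  shows "measure (normal_sample n \<theta>) {y \<in> space (normal_sample n \<theta>). e < \<bar>sample_sd n y - 1\<bar>}
    \<le> (4 * real n + 4) / ((real n - 1)\<^sup>2 * e\<^sup>2)"
proof -
  interpret prob_space "normal_sample n \<theta>"
    by (rule prob_space_normal_sample)
  let ?M = "normal_sample n \<theta>"
  define A where "A y = (\<Sum>i=1..n. (y i - \<theta>)\<^sup>2 - 1)" for y :: "nat \<Rightarrow> real"
  define B where "B y = real n * (sample_mean n y - \<theta>)\<^sup>2 - 1" for y
  have comp: "distributed ?M lborel (\<lambda>y. y i - \<theta>) (normal_density 0 1)" if "i \<in> {1..n}" for i
    using normal_density_affine[OF distributed_normal_sample_component[OF that, of \<theta>],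
        where \<alpha> = 1 and \<beta> = "- \<theta>"] by simp
  note sq = centred_square_normal[OF comp, simplified]
  have ind: "indep_vars (\<lambda>_. borel) (\<lambda>i y. (y i - \<theta>)\<^sup>2 - 1) {1..n}"
    using indep_vars_compose2[OF indep_vars_normal_sample[of n \<theta>],
        of "\<lambda>_ x. (x - \<theta>)\<^sup>2 - 1" "\<lambda>_. borel"] assms by simp
  have "integrable ?M (\<lambda>y. (A y)\<^sup>2) \<and>
      expectation (\<lambda>y. (A y)\<^sup>2) = (\<Sum>i\<in>{1..n}. expectation (\<lambda>y. ((y i - \<theta>)\<^sup>2 - 1)\<^sup>2))"
    unfolding A_def by (rule square_sum_indep) (use ind sq in auto)
  moreover have "(\<Sum>i\<in>{1..n}. expectation (\<lambda>y. ((y i - \<theta>)\<^sup>2 - 1)\<^sup>2)) = (\<Sum>i\<in>{1..n}. 2)"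
    by (intro sum.cong) (use sq in auto)
  ultimately have A: "integrable ?M (\<lambda>y. (A y)\<^sup>2)" "expectation (\<lambda>y. (A y)\<^sup>2) = 2 * n"
    by auto
  have "(\<lambda>y. (B y)\<^sup>2) = (\<lambda>y. (real n)\<^sup>2 * ((sample_mean n y - \<theta>)\<^sup>2 - (1 / sqrt n)\<^sup>2)\<^sup>2)"
    using assms by (auto simp: fun_eq_iff B_def power_divide power_mult_distrib[symmetric] right_diff_distrib)
  moreover have "(1 / sqrt n) ^ 4 = 1 / (real n)\<^sup>2"
    using power_mult[of "1 / sqrt n" 2 2] by (simp add: power_divide)
  ultimately have B: "integrable ?M (\<lambda>y. (B y)\<^sup>2)" "expectation (\<lambda>y. (B y)\<^sup>2) = 2"
    using centred_square_normal[OF distributed_sample_mean[of n \<theta>]] assms by simp_all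
  have mono: "prob {y \<in> space ?M. e < \<bar>sample_sd n y - 1\<bar>}
      \<le> prob {y \<in> space ?M. (real n - 1)\<^sup>2 * e\<^sup>2 \<le> 2 * (A y)\<^sup>2 + 2 * (B y)\<^sup>2}"
  proof (rule finite_measure_mono)
    show "{y \<in> space ?M. e < \<bar>sample_sd n y - 1\<bar>}
      \<subseteq> {y \<in> space ?M. (real n - 1)\<^sup>2 * e\<^sup>2 \<le> 2 * (A y)\<^sup>2 + 2 * (B y)\<^sup>2}"
    proof safe
      fix y assume e: "e < \<bar>sample_sd n y - 1\<bar>"
      have "\<bar>sample_sd n y - 1\<bar> * 1 \<le> \<bar>sample_sd n y - 1\<bar> * \<bar>sample_sd n y + 1\<bar>"
        using sample_sd_nonneg[OF assms(1), of y] by (intro mult_left_mono) auto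
      also have "\<dots> = \<bar>(sample_sd n y)\<^sup>2 - 1\<bar>"
        by (simp add: abs_mult[symmetric] power2_eq_square algebra_simps)
      finally have "e \<le> \<bar>(sample_sd n y)\<^sup>2 - 1\<bar>"
        using e by simp
      then have "(real n - 1) * e \<le> \<bar>(real n - 1) * ((sample_sd n y)\<^sup>2 - 1)\<bar>"
        using assms by (simp add: abs_mult)
      then have "(real n - 1) * e \<le> \<bar>A y - B y\<bar>"
        using sample_variance_decomposition[OF assms(1), of y \<theta>] by (simp add: A_def B_def)
      then have "((real n - 1) * e)\<^sup>2 \<le> \<bar>A y - B y\<bar>\<^sup>2"
        using assms by (intro power_mono) auto
      also have "\<dots> \<le> 2 * (A y)\<^sup>2 + 2 * (B y)\<^sup>2"
        using zero_le_power2[of "A y + B y"] by (simp add: power2_sum power2_diff)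
      finally show "(real n - 1)\<^sup>2 * e\<^sup>2 \<le> 2 * (A y)\<^sup>2 + 2 * (B y)\<^sup>2"
        by (simp add: power_mult_distrib)
    qed
  qed (use borel_measurable_integrable[OF A(1)] borel_measurable_integrable[OF B(1)] in measurable)
  \<comment> \<open>The schematic set \<open>A\<close> of Markov's inequality is absent from its conclusion.\<close>
  also have "\<dots> \<le> expectation (\<lambda>y. 2 * (A y)\<^sup>2 + 2 * (B y)\<^sup>2) / ((real n - 1)\<^sup>2 * e\<^sup>2)"
    using A B assms by (intro integral_Markov_inequality_measure[where A = "{}"]) auto
  also have "expectation (\<lambda>y. 2 * (A y)\<^sup>2 + 2 * (B y)\<^sup>2) = 4 * real n + 4"
    using A B by simp
  finally show ?thesis .
qed

section \<open>Minimal coverage\<close>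

lemma measurable_soft_threshold [measurable (raw)]:
  assumes [measurable]: "f \<in> borel_measurable M" "g \<in> borel_measurable M"
  shows "(\<lambda>x. soft_threshold (f x) (g x)) \<in> borel_measurable M"
  unfolding soft_threshold_def by measurable

abbreviation interval_types :: "(real \<Rightarrow> real \<Rightarrow> real set) set" where
  "interval_types \<equiv> {\<lambda>l u. {l..u}, \<lambda>l u. {l<..<u}, \<lambda>l u. {l<..u}, \<lambda>l u. {l..<u}}"

lemma interval_types_between:
  assumes "I \<in> interval_types"
  shows "{l<..<u} \<subseteq> I l u" "I l u \<subseteq> {l..u}"
  using assms by auto

lemma sets_scaled_interval_coverage:
  assumes "I \<in> interval_types" and [measurable]: "s \<in> borel_measurable (normal_sample n \<theta>)"
  shows "{y \<in> space (normal_sample n \<theta>). \<theta> \<in> scaled_interval I s h c n y}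
    \<in> sets (normal_sample n \<theta>)"
proof -
  let ?M = "normal_sample n \<theta>"
  define l where "l y = soft_threshold (s y * h) (sample_mean n y) - s y * c" for y
  define u where "u y = soft_threshold (s y * h) (sample_mean n y) + s y * c" for y
  have [measurable]: "l \<in> borel_measurable ?M" "u \<in> borel_measurable ?M"
    unfolding l_def u_def by measurable
  have "{y \<in> space ?M. l y \<le> \<theta> \<and> \<theta> \<le> u y} \<in> sets ?M" "{y \<in> space ?M. l y < \<theta> \<and> \<theta> < u y} \<in> sets ?M"
    "{y \<in> space ?M. l y < \<theta> \<and> \<theta> \<le> u y} \<in> sets ?M" "{y \<in> space ?M. l y \<le> \<theta> \<and> \<theta> < u y} \<in> sets ?M"
    by measurable
  then have "{y \<in> space ?M. \<theta> \<in> I (l y) (u y)} \<in> sets ?M"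
    using assms(1) by auto
  then show ?thesis
    by (simp add: scaled_interval_def l_def u_def)
qed

text \<open>The upper bound comes from a single parameter, chosen so large that it exceeds the half-width
  \<open>s \<cdot> c\<close> whenever \<open>\<bar>s - 1\<bar> \<le> e\<close>. The lower bound holds at every parameter.\<close>

lemma inf_coverage_scaled_approx:
  assumes I: "I \<in> interval_types"
    and n: "1 \<le> n" and h: "0 < h" and c: "0 \<le> c" and e: "0 < e" "e \<le> 1/2"
    and s [measurable]: "\<And>\<theta>. s \<in> borel_measurable (normal_sample n \<theta>)"
    and s_nonneg: "\<And>y. 0 \<le> s y"
    and p: "\<And>\<theta>. measure (normal_sample n \<theta>) {y \<in> space (normal_sample n \<theta>). e < \<bar>s y - 1\<bar>} \<le> p"
  shows "\<bar>inf_coverage n (scaled_interval I s h c n)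
      - measure (centred_normal (1 / sqrt n)) {h - c .. h + c}\<bar> \<le> 8 * e + p"
proof -
  let ?M = "\<lambda>\<theta>. normal_sample n \<theta>"
  let ?K = "measure (centred_normal (1 / sqrt n)) {h - c .. h + c}"
  define cov where "cov \<theta> = {y \<in> space (?M \<theta>). \<theta> \<in> scaled_interval I s h c n y}" for \<theta>
  define far where "far \<theta> = {y \<in> space (?M \<theta>). e < \<bar>s y - 1\<bar>}" for \<theta>
  define near where
    "near \<theta> u = {y \<in> space (?M \<theta>). sample_mean n y - \<theta> \<in> {x. \<bar>x - u\<bar> \<le> e * \<bar>u\<bar>}}" for \<theta> u
  define hit where "hit \<theta> u v = {y \<in> space (?M \<theta>). sample_mean n y - \<theta> \<in> {u .. v}}" for \<theta> u v
  have sets [measurable]: "cov \<theta> \<in> sets (?M \<theta>)" "far \<theta> \<in> sets (?M \<theta>)"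
    "near \<theta> u \<in> sets (?M \<theta>)" "hit \<theta> u v \<in> sets (?M \<theta>)" for \<theta> u v
  proof -
    show "cov \<theta> \<in> sets (?M \<theta>)"
      unfolding cov_def by (rule sets_scaled_interval_coverage[OF I s])
    show "far \<theta> \<in> sets (?M \<theta>)" "near \<theta> u \<in> sets (?M \<theta>)" "hit \<theta> u v \<in> sets (?M \<theta>)"
      unfolding far_def near_def hit_def by measurable
  qed
  have near_le: "measure (?M \<theta>) (near \<theta> u) \<le> 4 * e" for \<theta> u
    unfolding near_def using n e
    by (subst measure_sample_mean) (auto intro!: measure_normal_relative_nbhd_le)
  have far_le: "measure (?M \<theta>) (far \<theta>) \<le> p" for \<theta>
    unfolding far_def by (rule p)
  have hit_eq: "measure (?M \<theta>) (hit \<theta> (h - c) (h + c)) = ?K" for \<theta>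
    unfolding hit_def using n by (subst measure_sample_mean) auto
  have hit_mirror: "measure (?M \<theta>) (hit \<theta> (- (h + c)) (- (h - c))) = ?K" for \<theta>
    unfolding hit_def using n measure_centred_normal_mirror[of "1 / sqrt n" "h + c" "h - c"]
    by (subst measure_sample_mean) simp_all
  have union_le: "measure (?M \<theta>) X \<le> measure (?M \<theta>) Y + (8 * e + p)"
    if "X \<subseteq> Y \<union> near \<theta> u \<union> near \<theta> v \<union> far \<theta>" "Y \<in> sets (?M \<theta>)" for \<theta> X Y u v
  proof -
    interpret prob_space "?M \<theta>"
      by (rule prob_space_normal_sample)
    have "prob X \<le> prob (Y \<union> near \<theta> u \<union> near \<theta> v \<union> far \<theta>)"
      using that by (intro finite_measure_mono) auto
    also have "\<dots> \<le> prob Y + prob (near \<theta> u) + prob (near \<theta> v) + prob (far \<theta>)"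
      using that(2) sets
      by (intro order.trans[OF measure_Un_le] add_right_mono order.trans[OF measure_Un_le] order.refl)
         auto
    also have "\<dots> \<le> prob Y + (8 * e + p)"
      using near_le[of \<theta> u] near_le[of \<theta> v] far_le[of \<theta>] by simp
    finally show ?thesis .
  qed
  have scale: "\<bar>s y * (h - c) - (h - c)\<bar> \<le> e * \<bar>h - c\<bar>" "\<bar>s y * (h + c) - (h + c)\<bar> \<le> e * \<bar>h + c\<bar>"
    if "\<not> e < \<bar>s y - 1\<bar>" for y
    using that by (intro abs_scaled_diff_le; simp)+
  have sh: "0 \<le> s y * h" "0 \<le> s y * c" for y
    using s_nonneg h c by simp_all
  have lower: "?K - (8 * e + p) \<le> measure (?M \<theta>) (cov \<theta>)" for \<theta>
  proof (cases "0 \<le> \<theta>")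
    case True
    have "hit \<theta> (h - c) (h + c) \<subseteq> cov \<theta> \<union> near \<theta> (h - c) \<union> near \<theta> (h + c) \<union> far \<theta>"
    proof (rule subsetI, rule ccontr)
      fix y assume y: "y \<in> hit \<theta> (h - c) (h + c)"
        and out: "y \<notin> cov \<theta> \<union> near \<theta> (h - c) \<union> near \<theta> (h + c) \<union> far \<theta>"
      define d where "d = sample_mean n y - \<theta>"
      have "h - c \<le> d" "d \<le> h + c" "e * \<bar>h - c\<bar> < \<bar>d - (h - c)\<bar>"
        "e * \<bar>h + c\<bar> < \<bar>d - (h + c)\<bar>" "\<not> e < \<bar>s y - 1\<bar>"
        using y out by (auto simp: hit_def near_def far_def d_def)
      then have "s y * (h - c) < d" "d < s y * (h + c)"
        using scale[of y] by linarith+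
      then have "s y * h - s y * c < d" "d < s y * h + s y * c"
        by (simp_all add: algebra_simps)
      then have "\<theta> \<in> scaled_interval I s h c n y"
        unfolding scaled_interval_def
        using soft_threshold_coversI[OF sh(1) True sh(2), of y y "sample_mean n y"]
        by (intro subsetD[OF interval_types_between(1)[OF I]]) (simp add: d_def)
      then show False
        using y out by (auto simp: cov_def hit_def)
    qed
    from union_le[OF this sets(1)] show ?thesis
      by (simp add: hit_eq)
  next
    case False
    have "hit \<theta> (- (h + c)) (- (h - c))
      \<subseteq> cov \<theta> \<union> near \<theta> (- (h + c)) \<union> near \<theta> (- (h - c)) \<union> far \<theta>"
    proof (rule subsetI, rule ccontr)
      fix y assume y: "y \<in> hit \<theta> (- (h + c)) (- (h - c))"
        and out: "y \<notin> cov \<theta> \<union> near \<theta> (- (h + c)) \<union> near \<theta> (- (h - c)) \<union> far \<theta>"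
      define d where "d = sample_mean n y - \<theta>"
      have q: "- (h + c) \<le> d" "d \<le> - (h - c)" "e * \<bar>- (h - c)\<bar> < \<bar>d - (- (h - c))\<bar>"
        "e * \<bar>- (h + c)\<bar> < \<bar>d - (- (h + c))\<bar>" "\<not> e < \<bar>s y - 1\<bar>"
        using y out by (auto simp: hit_def near_def far_def d_def)
      have "- (s y * (h + c)) < d" "d < - (s y * (h - c))"
        using q scale[OF q(5)] unfolding abs_minus_cancel by linarith+
      then have "- (s y * h + s y * c) < d" "d < - (s y * h - s y * c)"
        by (simp_all add: algebra_simps)
      then have "\<theta> \<in> scaled_interval I s h c n y"
        unfolding scaled_interval_def
        using soft_threshold_coversI_nonpos[OF sh(1) _ sh(2), of \<theta> y y "sample_mean n y"] False
        by (intro subsetD[OF interval_types_between(1)[OF I]]) (simp add: d_def)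
      then show False
        using y out by (auto simp: cov_def hit_def)
    qed
    from union_le[OF this sets(1)] show ?thesis
      by (simp only: hit_mirror)
  qed
  define \<theta>' where "\<theta>' = (1 + e) * c + 1"
  have "cov \<theta>' \<subseteq> hit \<theta>' (h - c) (h + c) \<union> near \<theta>' (h - c) \<union> near \<theta>' (h + c) \<union> far \<theta>'"
  proof (rule subsetI, rule ccontr)
    fix y assume y: "y \<in> cov \<theta>'"
      and out: "y \<notin> hit \<theta>' (h - c) (h + c) \<union> near \<theta>' (h - c) \<union> near \<theta>' (h + c) \<union> far \<theta>'"
    define d where "d = sample_mean n y - \<theta>'"
    have y_space: "y \<in> space (?M \<theta>')"
      using y by (simp add: cov_def)
    have "s y * c \<le> (1 + e) * c"
      using out y_space c by (intro mult_right_mono) (auto simp: far_def)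
    then have "s y * c < \<theta>'"
      by (simp add: \<theta>'_def)
    moreover have "\<theta>' \<in> {soft_threshold (s y * h) (sample_mean n y) - s y * c
        .. soft_threshold (s y * h) (sample_mean n y) + s y * c}"
      using y by (intro subsetD[OF interval_types_between(2)[OF I]])
        (simp add: cov_def scaled_interval_def)
    ultimately have "s y * h - s y * c \<le> d" "d \<le> s y * h + s y * c"
      using soft_threshold_covers_imp[OF sh(1) _ sh(2), of y \<theta>' y "sample_mean n y"]
      by (simp_all add: d_def)
    then have "s y * (h - c) \<le> d" "d \<le> s y * (h + c)"
      by (simp_all add: algebra_simps)
    moreover have "\<not> (h - c \<le> d \<and> d \<le> h + c)" "e * \<bar>h - c\<bar> < \<bar>d - (h - c)\<bar>"
      "e * \<bar>h + c\<bar> < \<bar>d - (h + c)\<bar>" "\<not> e < \<bar>s y - 1\<bar>"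
      using out y_space by (auto simp: hit_def near_def far_def d_def)
    ultimately show False
      using scale[of y] by linarith
  qed
  from union_le[OF this sets(4)] have upper: "measure (?M \<theta>') (cov \<theta>') \<le> ?K + (8 * e + p)"
    by (simp add: hit_eq)
  have inf: "inf_coverage n (scaled_interval I s h c n) = (INF \<theta>. measure (?M \<theta>) (cov \<theta>))"
    by (simp add: inf_coverage_def cov_def)
  have "inf_coverage n (scaled_interval I s h c n) \<le> measure (?M \<theta>') (cov \<theta>')"
    unfolding inf by (rule cINF_lower) (auto intro!: bdd_belowI[where m = 0])
  moreover have "?K - (8 * e + p) \<le> inf_coverage n (scaled_interval I s h c n)"
    unfolding inf by (rule cINF_greatest) (use lower in auto)
  ultimately show ?thesis
    using upper by linarith
qed

theorem theorem8:
  fixes \<eta> a :: "nat \<Rightarrow> real"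
  assumes "\<And>n. n \<ge> 2 \<Longrightarrow> \<eta> n > 0"
    and "\<And>n. n \<ge> 2 \<Longrightarrow> a n \<ge> 0"
  shows "\<forall>I \<in> {\<lambda>l u. {l..u}, \<lambda>l u. {l<..<u}, \<lambda>l u. {l<..u}, \<lambda>l u. {l..<u}}.
    (\<lambda>n. inf_coverage n (interval_feasible I \<eta> a n) - inf_coverage n (interval_known I \<eta> a n))
      \<longlonglongrightarrow> 0"
proof
  fix I assume I: "I \<in> interval_types"
  let ?f = "\<lambda>n. inf_coverage n (interval_feasible I \<eta> a n)"
  let ?g = "\<lambda>n. inf_coverage n (interval_known I \<eta> a n)"
  define p where "p e n = (4 * real n + 4) / ((real n - 1)\<^sup>2 * e\<^sup>2)" for e n
  have bound: "\<bar>?f n - ?g n\<bar> \<le> 16 * e + p e n" if n: "2 \<le> n" and e: "0 < e" "e \<le> 1/2" for n e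
  proof -
    let ?K = "measure (centred_normal (1 / sqrt n)) {\<eta> n - a n .. \<eta> n + a n}"
    have "\<bar>?f n - ?K\<bar> \<le> 8 * e + p e n"
      unfolding interval_feasible_eq_scaled p_def
      using n e assms I by (intro inf_coverage_scaled_approx sample_sd_deviation sample_sd_nonneg) auto
    moreover have "\<bar>?g n - ?K\<bar> \<le> 8 * e + 0"
      unfolding interval_known_eq_scaled
      using n e assms I by (intro inf_coverage_scaled_approx) auto
    ultimately show ?thesis
      by linarith
  qed
  show "(\<lambda>n. ?f n - ?g n) \<longlonglongrightarrow> 0"
  proof (rule tendstoI)
    fix r :: real assume "0 < r"
    \<comment> \<open>The term linear in the tolerance then contributes at most half of \<open>r\<close>.\<close>
    define e where "e = min (1/2) (r / 32)"
    have e: "0 < e" "e \<le> 1/2" "16 * e \<le> r / 2"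
      using \<open>0 < r\<close> by (auto simp: e_def)
    have "p e \<longlonglongrightarrow> 0"
      unfolding p_def using e(1) by real_asymp
    then have "\<forall>\<^sub>F n in sequentially. p e n < r / 2"
      using \<open>0 < r\<close> by (intro order_tendstoD(2)) auto
    then show "\<forall>\<^sub>F n in sequentially. dist (?f n - ?g n) 0 < r"
      using eventually_ge_at_top[of 2]
    proof eventually_elim
      case (elim n)
      then show ?case
        using bound[of n e] e by simp
    qed
  qed
qed

end
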